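(* For every integer $k\ge 0$, let $A_k(z)=\sum_{P} z^{|P|}$, where the sum runs over all skew Dyck paths $P$ that start at level $0$, end at level $k$, and contain no contiguous occurrence of the three steps up--down--left, and $|P|$ denotes the number of steps of $P$. Let $u_1$ be the solution of the algebraic equation $$-u^2+zu^3+2zu-u^2z^2-uz^3-z^4=0$$ whose expansion around $z=0$ is $u_1=\frac1z-z-z^3-2z^5-6z^7-20z^9-71z^{11}-262z^{13}-\cdots$. Then $$A_k(z)=\frac{1-zu_1}{z^2u_1^{k}}.$$
   Context: A skew Dyck path is a finite lattice path in the plane starting at $(0,0)$, using up steps $U=(1,1)$, down steps $D=(1,-1)$ and left steps $L=(-1,-1)$, never going below the line $y=0$, and never overlapping itself; equivalently, the contiguous pairs $UL$ and $LU$ never occur. The level of a point is its $y$-coordinate; a path ends at level $k$ if its final point has $y$-coordinate $k$ (the $x$-coordinate of the endpoint is arbitrary). "Up--down--left" is the contiguous pattern $UDL$. *)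

theory Defs
  imports
    Complex_Main
    "HOL-Library.Product_Plus"
    "HOL-Library.Sublist"
    "HOL-Computational_Algebra.Formal_Laurent_Series"
begin

datatype step = U | D | L

fun step_vec :: "step \<Rightarrow> int \<times> int" where
  "step_vec U = (1, 1)"
| "step_vec D = (1, -1)"
| "step_vec L = (-1, -1)"

text \<open>The lattice point reached from the origin after the first \<open>i\<close> steps of \<open>P\<close>.\<close>

definition vertex :: "step list \<Rightarrow> nat \<Rightarrow> int \<times> int" where
  "vertex P i = sum_list (map step_vec (take i P))"

definition end_level :: "step list \<Rightarrow> int" where
  "end_level P = snd (vertex P (length P))"

text \<open>
  All vertices \<open>(x, y)\<close> have \<open>x + y\<close> even, so the segments of two steps either coincide as
  unoriented segments or have at most one point in common. Hence a path overlaps itself iff it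
  traverses some unoriented segment twice.
\<close>

definition self_overlapping :: "step list \<Rightarrow> bool" where
  "self_overlapping P \<longleftrightarrow>
     (\<exists>i j. i < j \<and> j < length P \<and>
        {vertex P i, vertex P (Suc i)} = {vertex P j, vertex P (Suc j)})"

definition skew_dyck_path :: "step list \<Rightarrow> bool" where
  "skew_dyck_path P \<longleftrightarrow>
     (\<forall>i \<le> length P. snd (vertex P i) \<ge> 0) \<and> \<not> self_overlapping P"

definition UDL_avoiding_paths :: "nat \<Rightarrow> step list set" where
  "UDL_avoiding_paths k =
     {P. skew_dyck_path P \<and> end_level P = int k \<and> \<not> sublist [U, D, L] P}"

text \<open>The generating function \<open>A\<^sub>k(z)\<close>, that is, the formal sum of \<open>z^|P|\<close> over the paths \<open>P\<close>.\<close>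

definition A :: "nat \<Rightarrow> complex fps" where
  "A k = Abs_fps (\<lambda>n. of_nat (card {P \<in> UDL_avoiding_paths k. length P = n}))"

abbreviation z :: "complex fls" where
  "z \<equiv> fls_X"

text \<open>
  \<open>u\<close> is a formal Laurent series in \<open>z\<close> that solves the algebraic equation and whose expansion
  starts with the displayed terms; the next term of the (odd) series is the one in \<open>z^15\<close>.
\<close>

definition is_u1 :: "complex fls \<Rightarrow> bool" where
  "is_u1 u \<longleftrightarrow>
     - (u^2) + z * u^3 + 2 * z * u - u^2 * z^2 - u * z^3 - z^4 = 0 \<and>
     (\<forall>n < 15. fls_nth u n =
        fls_nth (1 / z - z - z^3 - 2 * z^5 - 6 * z^7 - 20 * z^9 - 71 * z^11 - 262 * z^13) n)"

lemma finite_paths_of_length: "finite {P \<in> UDL_avoiding_paths k. length P = n}"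
proof (rule finite_subset)
  show "{P \<in> UDL_avoiding_paths k. length P = n} \<subseteq> {P. set P \<subseteq> {U, D, L} \<and> length P = n}"
    by (auto intro: step.exhaust)
  show "finite {P. set P \<subseteq> {U, D, L} \<and> length P = n}"
    by (rule finite_lists_length_eq) simp
qed

lemma vertex_Suc: "i < length P \<Longrightarrow> vertex P (Suc i) = vertex P i + step_vec (P ! i)"
  by (simp add: vertex_def take_Suc_conv_app_nth)

lemma sublist_pairD:
  assumes "sublist [a, b] P"
  obtains i where "Suc i < length P" "P ! i = a" "P ! Suc i = b"
proof -
  from assms obtain xs ys where "P = xs @ [a, b] @ ys" by (auto simp: sublist_def)
  then show thesis by (intro that[of "length xs"]) (auto simp: nth_append)
qed

lemma sublist_pairI:
  assumes "Suc i < length P"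
  shows "sublist [P ! i, P ! Suc i] P"
proof -
  have "P = take i P @ [P ! i, P ! Suc i] @ drop (Suc (Suc i)) P"
    using assms by (simp add: Cons_nth_drop_Suc)
  then show ?thesis unfolding sublist_def by blast
qed

lemma self_overlapping_iff:
  "self_overlapping P \<longleftrightarrow> sublist [U, L] P \<or> sublist [L, U] P"
proof
  assume "sublist [U, L] P \<or> sublist [L, U] P"
  then obtain i where i: "Suc i < length P"
    and "P ! i = U \<and> P ! Suc i = L \<or> P ! i = L \<and> P ! Suc i = U"
    by (metis sublist_pairD)
  then have "vertex P (Suc (Suc i)) = vertex P i"
    by (auto simp: vertex_Suc prod_eq_iff)
  then have "{vertex P i, vertex P (Suc i)} = {vertex P (Suc i), vertex P (Suc (Suc i))}"
    by auto
  with i show "self_overlapping P"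
    unfolding self_overlapping_def by blast
next
  assume "self_overlapping P"
  then obtain i j where ij: "i < j" "j < length P"
    and eq: "{vertex P i, vertex P (Suc i)} = {vertex P j, vertex P (Suc j)}"
    unfolding self_overlapping_def by blast
  show "sublist [U, L] P \<or> sublist [L, U] P"
  proof (rule ccontr)
    assume "\<not> (sublist [U, L] P \<or> sublist [L, U] P)"
    then have no: "\<not> (P ! m = U \<and> P ! Suc m = L)" "\<not> (P ! m = L \<and> P ! Suc m = U)"
      if "Suc m < length P" for m
      using sublist_pairI[OF that] by auto
    define d where "d m = fst (vertex P m) - snd (vertex P m)" for m
    have d_Suc: "d (Suc m) = d m + (if P ! m = D then 2 else 0)" if "m < length P" for m
      using that by (cases "P ! m") (auto simp: d_def vertex_Suc)
    have d_mono: "d m \<le> d n" if "m \<le> n" "n \<le> length P" for m n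
      using that
    proof (induction n rule: dec_induct)
      case (step n)
      then show ?case using d_Suc[of n] by auto
    qed simp
    have ds: "{d i, d (Suc i)} = {d j, d (Suc j)}"
      using arg_cong[OF eq, of "image (\<lambda>p. fst p - snd p)"] by (simp add: d_def)
    have "d (Suc i) \<le> d j" "d j \<le> d (Suc j)" "d i \<le> d (Suc i)"
      using ij by (auto intro: d_mono)
    with ds have deq: "d i = d (Suc j)"
      by (auto simp: doubleton_eq_iff)
    have notD: "P ! m \<noteq> D" if "i \<le> m" "m \<le> j" for m
      using that ij deq d_Suc[of m] d_mono[of i m] d_mono[of "Suc m" "Suc j"]
      by (auto split: if_splits)
    have same: "P ! m = P ! i" if "i \<le> m" "m \<le> j" for m
      using that
    proof (induction m rule: dec_induct)
      case (step m)
      have "Suc m < length P" using step.prems ij by simp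
      then show ?case
        using step no[of m] notD[of m] notD[of "Suc m"]
        by (cases "P ! m"; cases "P ! Suc m") auto
    qed simp
    define y where "y m = snd (vertex P m)" for m
    have y: "y m = y i + int (m - i) * snd (step_vec (P ! i))" if "i \<le> m" "m \<le> Suc j" for m
      using that
    proof (induction m rule: dec_induct)
      case (step m)
      then have "y (Suc m) = y m + snd (step_vec (P ! i))"
        using same[of m] ij by (simp add: y_def vertex_Suc)
      with step show ?case by (simp add: Suc_diff_le algebra_simps)
    qed simp
    have "{y i, y (Suc i)} = {y j, y (Suc j)}"
      using arg_cong[OF eq, of "image snd"] by (simp add: y_def)
    moreover have "snd (step_vec (P ! i)) = 1 \<or> snd (step_vec (P ! i)) = -1"
      by (cases "P ! i") auto
    ultimately show False
      using y[of "Suc i"] y[of j] y[of "Suc j"] ij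
      by (auto simp: doubleton_eq_iff Suc_diff_le)
  qed
qed

lemma skew_dyck_path_iff:
  "skew_dyck_path P \<longleftrightarrow>
     (\<forall>i \<le> length P. snd (vertex P i) \<ge> 0) \<and> \<not> sublist [U, L] P \<and> \<not> sublist [L, U] P"
  by (simp add: skew_dyck_path_def self_overlapping_iff)

end

theory Submission
  imports Defs
begin

text \<open>
  Read a path from left to right and record its level together with one of four endings: up step
  (or empty path), peak \<open>UD\<close>, any other down step, left step. A step can be appended or not
  depending only on this data, so the generating functions by ending and level satisfy a linear
  system. Because the empty path may be counted as ending with an up step (no down-going step is
  possible at level \<open>0\<close> anyway), the system is solved exactly by geometric sequences
  \<open>c \<cdot> v\<^sup>k\<close>, where \<open>v\<close> is the power series with
  \<open>v = z (1 - z v + 2 v\<^sup>2 - z\<^sup>2 v\<^sup>2 - z\<^sup>3 v\<^sup>3)\<close>. This is the given cubic equation for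
  \<open>u = 1 / v\<close>. The substitution \<open>u = w / z\<close> turns that cubic into an equation that has
  the simple root \<open>w = 1\<close> at \<open>z = 0\<close>; by Hensel-type uniqueness, a polynomial that satisfies it
  up to \<open>O(z\<^sup>1\<^sup>6)\<close> agrees with \<open>w\<close> to that order.
\<close>

section \<open>Paths by level and ending\<close>

datatype ending = Up | Peak | Down | Left

fun rev_ending :: "step list \<Rightarrow> ending" where
  "rev_ending [] = Up"
| "rev_ending (U # _) = Up"
| "rev_ending (D # U # _) = Peak"
| "rev_ending (D # _) = Down"
| "rev_ending (L # _) = Left"

definition ending :: "step list \<Rightarrow> ending" where
  "ending P = rev_ending (rev P)"

lemma ending_Nil [simp]: "ending [] = Up"
  by (simp add: ending_def)

lemma ending_snoc_U [simp]: "ending (P @ [U]) = Up"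
  by (simp add: ending_def)

lemma ending_snoc_L [simp]: "ending (P @ [L]) = Left"
  by (simp add: ending_def)

lemma ending_eq_Left_iff: "ending P = Left \<longleftrightarrow> suffix [L] P"
  unfolding ending_def suffix_to_prefix
  by (cases "rev P" rule: rev_ending.cases) auto

lemma ending_eq_Up_iff: "ending P = Up \<longleftrightarrow> P = [] \<or> suffix [U] P"
  unfolding ending_def suffix_to_prefix
  by (cases "rev P" rule: rev_ending.cases) auto

lemma ending_eq_Peak_iff: "ending P = Peak \<longleftrightarrow> suffix [U, D] P"
  unfolding ending_def suffix_to_prefix
  by (cases "rev P" rule: rev_ending.cases) auto

text \<open>The empty path must be excluded: it counts as \<open>Up\<close>, yet the one-step word
  \<open>[D]\<close> is classified as \<open>Down\<close>, not \<open>Peak\<close>.\<close>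

lemma ending_snoc_D:
  "P \<noteq> [] \<Longrightarrow> ending (P @ [D]) = (if ending P = Up then Peak else Down)"
  unfolding ending_def by (cases "rev P" rule: rev_ending.cases) auto

section \<open>Appending one step to a path\<close>

lemma end_level_Nil [simp]: "end_level [] = 0"
  by (simp add: end_level_def vertex_def)

lemma end_level_snoc: "end_level (P @ [s]) = end_level P + snd (step_vec s)"
  by (simp add: end_level_def vertex_def)

lemma levels_nonneg_snoc:
  "(\<forall>i \<le> length (P @ [s]). 0 \<le> snd (vertex (P @ [s]) i)) \<longleftrightarrow>
   (\<forall>i \<le> length P. 0 \<le> snd (vertex P i)) \<and> 0 \<le> end_level (P @ [s])"
proof -
  have "vertex (P @ [s]) i = vertex P i" if "i \<le> length P" for i
    using that by (simp add: vertex_def)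
  then show ?thesis
    by (auto simp: le_Suc_eq end_level_def)
qed

lemma suffix_pair_snoc: "suffix [a, b] (P @ [s]) \<longleftrightarrow> b = s \<and> suffix [a] P"
  using snoc_suffix_snoc[of "[a]" b P s] by simp

lemma suffix_triple_snoc: "suffix [a, b, c] (P @ [s]) \<longleftrightarrow> c = s \<and> suffix [a, b] P"
  using snoc_suffix_snoc[of "[a, b]" c P s] by simp

lemma UDL_avoiding_paths_iff:
  "P \<in> UDL_avoiding_paths k \<longleftrightarrow>
    (\<forall>i \<le> length P. 0 \<le> snd (vertex P i)) \<and> \<not> sublist [U, L] P \<and> \<not> sublist [L, U] P \<and>
    \<not> sublist [U, D, L] P \<and> end_level P = int k"
  by (auto simp: UDL_avoiding_paths_def skew_dyck_path_iff)

lemma end_level_nonneg: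
  "\<forall>i \<le> length P. 0 \<le> snd (vertex P i) \<Longrightarrow> 0 \<le> end_level P"
  by (simp add: end_level_def)

lemma Nil_in_UDL_avoiding_paths: "[] \<in> UDL_avoiding_paths k \<longleftrightarrow> k = 0"
  by (auto simp: UDL_avoiding_paths_iff vertex_def)

text \<open>\<open>LU\<close> is the only forbidden pattern that ends in an up step.\<close>

lemma snoc_U_in_UDL_avoiding_paths:
  "P @ [U] \<in> UDL_avoiding_paths k \<longleftrightarrow>
    (\<exists>j. k = Suc j \<and> P \<in> UDL_avoiding_paths j \<and> ending P \<noteq> Left)"
proof -
  have "(0 \<le> end_level P \<and> end_level P + 1 = int k) \<longleftrightarrow> (\<exists>j. k = Suc j \<and> end_level P = int j)"
    by (cases k) auto
  then show ?thesis
    unfolding UDL_avoiding_paths_iff levels_nonneg_snoc sublist_snoc suffix_pair_snoc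
      suffix_triple_snoc end_level_snoc ending_eq_Left_iff
    using end_level_nonneg[of P] by auto
qed

text \<open>No forbidden pattern ends in a down step, so only the level matters.\<close>

lemma snoc_D_in_UDL_avoiding_paths:
  "P @ [D] \<in> UDL_avoiding_paths k \<longleftrightarrow> P \<in> UDL_avoiding_paths (Suc k)"
  unfolding UDL_avoiding_paths_iff levels_nonneg_snoc sublist_snoc suffix_pair_snoc
      suffix_triple_snoc end_level_snoc
  by auto

text \<open>The patterns that end in a left step are \<open>UL\<close> and \<open>UDL\<close>; they
  correspond to the endings \<open>Up\<close> and \<open>Peak\<close>.\<close>

lemma snoc_L_in_UDL_avoiding_paths:
  "P @ [L] \<in> UDL_avoiding_paths k \<longleftrightarrow>
    P \<in> UDL_avoiding_paths (Suc k) \<and> ending P \<noteq> Up \<and> ending P \<noteq> Peak"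
proof -
  \<comment> \<open>\<open>ending P \<noteq> Up\<close> also rules out the empty path, which no
    pattern forbids; here the positive level rules it out anyway.\<close>
  have "P \<noteq> []" if "end_level P = int (Suc k)"
    using that by auto
  then show ?thesis
    unfolding UDL_avoiding_paths_iff levels_nonneg_snoc sublist_snoc suffix_pair_snoc
      suffix_triple_snoc end_level_snoc ending_eq_Up_iff ending_eq_Peak_iff
    by auto
qed

section \<open>Recursions for the number of paths by ending, level and length\<close>

definition paths_ending :: "ending \<Rightarrow> nat \<Rightarrow> nat \<Rightarrow> step list set" where
  "paths_ending q k n = {P \<in> UDL_avoiding_paths k. length P = n \<and> ending P = q}"

lemma finite_paths_ending [simp]: "finite (paths_ending q k n)"
  by (rule finite_subset[OF _ finite_paths_of_length[of k n]]) (auto simp: paths_ending_def)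

lemma paths_ending_disjoint: "q \<noteq> q' \<Longrightarrow> paths_ending q k n \<inter> paths_ending q' k n = {}"
  by (auto simp: paths_ending_def)

lemma paths_ending_0:
  "paths_ending q k 0 = (if q = Up \<and> k = 0 then {[]} else {})"
  by (auto simp: paths_ending_def Nil_in_UDL_avoiding_paths)

lemma length_Suc_snocE:
  assumes "length P = Suc n"
  obtains Q s where "P = Q @ [s]" "length Q = n"
  using assms by (cases P rule: rev_cases) auto

lemma set_eq_snoc_image:
  assumes "\<And>P. P \<in> S \<Longrightarrow> length P = Suc n" "\<And>P. P \<in> T \<Longrightarrow> length P = n"
    and "\<And>P s. length P = n \<Longrightarrow> P @ [s] \<in> S \<longleftrightarrow> s = a \<and> P \<in> T"
  shows "S = (\<lambda>P. P @ [a]) ` T"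
proof (intro set_eqI iffI)
  fix P assume "P \<in> S"
  then show "P \<in> (\<lambda>P. P @ [a]) ` T"
    using assms by (metis image_eqI length_Suc_snocE)
qed (use assms in auto)

lemma ending_snoc_D_path:
  "P \<in> UDL_avoiding_paths (Suc k) \<Longrightarrow> ending (P @ [D]) = (if ending P = Up then Peak else Down)"
  by (rule ending_snoc_D) (auto simp: Nil_in_UDL_avoiding_paths)

text \<open>A nonempty path of class \<open>Up\<close> ends in a genuine up step, hence at positive
  level. So at level 0 this class holds only the empty path, matching \<open>v ^ 0 = 1\<close>
  below.\<close>

lemma paths_ending_Up_Suc_0: "paths_ending Up 0 (Suc n) = {}"
proof -
  have "P @ [s] \<notin> paths_ending Up 0 (Suc n)" for P s
    by (cases s) (auto simp: paths_ending_def snoc_U_in_UDL_avoiding_paths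
        snoc_D_in_UDL_avoiding_paths ending_snoc_D_path)
  moreover have "P \<in> paths_ending Up 0 (Suc n) \<Longrightarrow> length P = Suc n" for P
    by (simp add: paths_ending_def)
  ultimately show ?thesis
    by (metis equals0I length_Suc_snocE)
qed

lemma paths_ending_Up_Suc_Suc:
  "paths_ending Up (Suc k) (Suc n) = (\<lambda>P. P @ [U]) `
    (paths_ending Up k n \<union> paths_ending Peak k n \<union> paths_ending Down k n)"
proof (rule set_eq_snoc_image)
  fix P :: "step list" and s assume "length P = n"
  then show "P @ [s] \<in> paths_ending Up (Suc k) (Suc n) \<longleftrightarrow> s = U \<and>
      P \<in> paths_ending Up k n \<union> paths_ending Peak k n \<union> paths_ending Down k n"
    by (cases s; cases "ending P") (auto simp: paths_ending_def snoc_U_in_UDL_avoiding_paths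
        snoc_D_in_UDL_avoiding_paths ending_snoc_D_path)
qed (auto simp: paths_ending_def)

lemma paths_ending_Peak_Suc:
  "paths_ending Peak k (Suc n) = (\<lambda>P. P @ [D]) ` paths_ending Up (Suc k) n"
proof (rule set_eq_snoc_image)
  fix P :: "step list" and s assume "length P = n"
  then show "P @ [s] \<in> paths_ending Peak k (Suc n) \<longleftrightarrow> s = D \<and> P \<in> paths_ending Up (Suc k) n"
    by (cases s; cases "ending P") (auto simp: paths_ending_def snoc_U_in_UDL_avoiding_paths
        snoc_D_in_UDL_avoiding_paths ending_snoc_D_path)
qed (auto simp: paths_ending_def)

lemma paths_ending_Down_Suc:
  "paths_ending Down k (Suc n) = (\<lambda>P. P @ [D]) `
    (paths_ending Peak (Suc k) n \<union> paths_ending Down (Suc k) n \<union> paths_ending Left (Suc k) n)"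
proof (rule set_eq_snoc_image)
  fix P :: "step list" and s assume "length P = n"
  then show "P @ [s] \<in> paths_ending Down k (Suc n) \<longleftrightarrow> s = D \<and> P \<in>
      paths_ending Peak (Suc k) n \<union> paths_ending Down (Suc k) n \<union> paths_ending Left (Suc k) n"
    by (cases s; cases "ending P") (auto simp: paths_ending_def snoc_U_in_UDL_avoiding_paths
        snoc_D_in_UDL_avoiding_paths ending_snoc_D_path)
qed (auto simp: paths_ending_def)

lemma paths_ending_Left_Suc:
  "paths_ending Left k (Suc n) = (\<lambda>P. P @ [L]) `
    (paths_ending Down (Suc k) n \<union> paths_ending Left (Suc k) n)"
proof (rule set_eq_snoc_image)
  fix P :: "step list" and s assume "length P = n"
  then show "P @ [s] \<in> paths_ending Left k (Suc n) \<longleftrightarrow> s = L \<and>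
      P \<in> paths_ending Down (Suc k) n \<union> paths_ending Left (Suc k) n"
    by (cases s; cases "ending P") (auto simp: paths_ending_def snoc_L_in_UDL_avoiding_paths
        snoc_D_in_UDL_avoiding_paths ending_snoc_D_path)
qed (auto simp: paths_ending_def)

lemma card_snoc_image: "card ((\<lambda>P. P @ [a]) ` S) = card S"
  by (rule card_image) (simp add: inj_on_def)

lemma card_paths_ending_union2:
  assumes "q \<noteq> q'"
  shows "card (paths_ending q k n \<union> paths_ending q' k n) =
    card (paths_ending q k n) + card (paths_ending q' k n)"
  by (intro card_Un_disjoint finite_paths_ending paths_ending_disjoint assms)

lemma card_paths_ending_union3:
  assumes "q \<noteq> q'" "q \<noteq> q''" "q' \<noteq> q''"
  shows "card (paths_ending q k n \<union> paths_ending q' k n \<union> paths_ending q'' k n) =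
    card (paths_ending q k n) + card (paths_ending q' k n) + card (paths_ending q'' k n)"
  by (subst card_Un_disjoint) (use assms in \<open>auto simp: card_paths_ending_union2
      Int_Un_distrib2 paths_ending_disjoint\<close>)

lemmas card_paths_ending_Suc =
  paths_ending_Up_Suc_Suc paths_ending_Peak_Suc paths_ending_Down_Suc paths_ending_Left_Suc
  card_snoc_image card_paths_ending_union2 card_paths_ending_union3

lemma card_paths_by_ending:
  "card {P \<in> UDL_avoiding_paths k. length P = n} =
    card (paths_ending Up k n) + card (paths_ending Peak k n) +
    card (paths_ending Down k n) + card (paths_ending Left k n)"
proof -
  have "{P \<in> UDL_avoiding_paths k. length P = n} =
      paths_ending Up k n \<union> paths_ending Peak k n \<union> paths_ending Down k n \<union> paths_ending Left k n"
    by (auto simp: paths_ending_def intro: ending.exhaust)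
  also have "card \<dots> = card (paths_ending Up k n \<union> paths_ending Peak k n \<union> paths_ending Down k n)
      + card (paths_ending Left k n)"
    by (rule card_Un_disjoint) (auto simp: Int_Un_distrib2 paths_ending_disjoint)
  finally show ?thesis
    by (simp add: card_paths_ending_union3)
qed

section \<open>Geometric solution of the linear system\<close>

lemma card_paths_ending_eq_coeff:
  fixes v d l :: "complex fps"
  assumes v: "v = fps_X * (1 + fps_X * v + d)"
    and d: "d = fps_X * v * (fps_X * v + d + l)"
    and l: "l = fps_X * v * (d + l)"
  shows "of_nat (card (paths_ending Up k n)) = fps_nth (v ^ k) n"
    and "of_nat (card (paths_ending Peak k n)) = fps_nth (fps_X * v * v ^ k) n"
    and "of_nat (card (paths_ending Down k n)) = fps_nth (d * v ^ k) n"
    and "of_nat (card (paths_ending Left k n)) = fps_nth (l * v ^ k) n"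
proof -
  \<comment> \<open>Each right-hand side has a factor \<open>fps_X\<close>. The vanishing constant
    terms give the case of length 0.\<close>
  have v0: "fps_nth v 0 = 0"
    by (subst v) simp
  have d0: "fps_nth d 0 = 0"
    by (subst d) simp
  have l0: "fps_nth l 0 = 0"
    by (subst l) simp
  \<comment> \<open>Multiplied by powers of \<open>v\<close>, the three hypotheses take the shape of
    the four append recursions: a shift of the level is a factor \<open>v\<close>, an appended step
    a factor \<open>fps_X\<close>.\<close>
  have vk: "v ^ Suc k = fps_X * (v ^ k + fps_X * v * v ^ k + d * v ^ k)" for k
    by (subst power_Suc, subst (1) v) (simp add: algebra_simps)
  have pk: "fps_X * v * v ^ k = fps_X * v ^ Suc k" for k
    by simp
  have dk: "d * v ^ k = fps_X * (fps_X * v * v ^ Suc k + d * v ^ Suc k + l * v ^ Suc k)" for k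
    by (subst (1) d) (simp add: algebra_simps)
  have lk: "l * v ^ k = fps_X * (d * v ^ Suc k + l * v ^ Suc k)" for k
    by (subst (1) l) (simp add: algebra_simps)
  \<comment> \<open>The four claims are proved jointly and for all levels, since length
    \<open>Suc n\<close> refers to other endings and neighbouring levels at length
    \<open>n\<close>.\<close>
  have "of_nat (card (paths_ending Up k n)) = fps_nth (v ^ k) n \<and>
    of_nat (card (paths_ending Peak k n)) = fps_nth (fps_X * v * v ^ k) n \<and>
    of_nat (card (paths_ending Down k n)) = fps_nth (d * v ^ k) n \<and>
    of_nat (card (paths_ending Left k n)) = fps_nth (l * v ^ k) n"
  proof (induction n arbitrary: k)
    case 0
    show ?case
      by (cases k) (auto simp: paths_ending_0 v0 d0 l0)
  next
    case (Suc n)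
    have "of_nat (card (paths_ending Up k (Suc n))) = fps_nth (v ^ k) (Suc n)"
    proof (cases k)
      case 0
      then show ?thesis by (simp add: paths_ending_Up_Suc_0)
    next
      case (Suc j)
      then show ?thesis
        unfolding Suc vk using Suc.IH[of j] by (simp add: card_paths_ending_Suc)
    qed
    moreover have "of_nat (card (paths_ending Peak k (Suc n))) = fps_nth (fps_X * v * v ^ k) (Suc n)"
      unfolding pk using Suc.IH[of "Suc k"]
      by (simp add: card_paths_ending_Suc del: power_Suc)
    moreover have "of_nat (card (paths_ending Down k (Suc n))) = fps_nth (d * v ^ k) (Suc n)"
      unfolding dk[of k] using Suc.IH[of "Suc k"]
      by (simp add: card_paths_ending_Suc del: power_Suc)
    moreover have "of_nat (card (paths_ending Left k (Suc n))) = fps_nth (l * v ^ k) (Suc n)"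
      unfolding lk[of k] using Suc.IH[of "Suc k"]
      by (simp add: card_paths_ending_Suc del: power_Suc)
    ultimately show ?case by blast
  qed
  then show "of_nat (card (paths_ending Up k n)) = fps_nth (v ^ k) n"
    and "of_nat (card (paths_ending Peak k n)) = fps_nth (fps_X * v * v ^ k) n"
    and "of_nat (card (paths_ending Down k n)) = fps_nth (d * v ^ k) n"
    and "of_nat (card (paths_ending Left k n)) = fps_nth (l * v ^ k) n"
    by blast+
qed

lemma A_eq_geometric:
  fixes v d l :: "complex fps"
  assumes "v = fps_X * (1 + fps_X * v + d)"
    and "d = fps_X * v * (fps_X * v + d + l)"
    and "l = fps_X * v * (d + l)"
  shows "A k = (1 + fps_X * v + d + l) * v ^ k"
proof (rule fps_ext)
  fix n
  show "fps_nth (A k) n = fps_nth ((1 + fps_X * v + d + l) * v ^ k) n"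
    by (simp add: A_def card_paths_by_ending card_paths_ending_eq_coeff[OF assms] distrib_right)
qed

text \<open>The factor \<open>fps_X^2 * v\<close> is not a unit, so the division is left to the
  Laurent series.\<close>

lemma fps_X_sq_mult_A:
  fixes v :: "complex fps"
  assumes v: "v = fps_X * (1 - fps_X * v + 2 * v^2 - fps_X^2 * v^2 - fps_X^3 * v^3)"
  shows "fps_X^2 * v * A k = (v - fps_X) * v ^ k"
proof -
  \<comment> \<open>Cramer's rule for the linear equations in \<open>d\<close> and \<open>l\<close>:
    \<open>c\<close> is the determinant (1 - xv)^2 - (xv)^2 with x = \<open>fps_X\<close>. Inserting
    \<open>d\<close> into v = x(1 + xv + d) and clearing \<open>c\<close> gives exactly the assumed
    equation for \<open>v\<close>.\<close>
  define c where "c = 1 - 2 * fps_X * v"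
  define d where "d = fps_X^2 * v^2 * (1 - fps_X * v) * inverse c"
  define l where "l = fps_X^3 * v^3 * inverse c"
  have c: "c * inverse c = 1"
    by (rule inverse_mult_eq_1') (simp add: c_def mult.assoc)
  then have c0: "c \<noteq> 0" by auto
  have cd: "c * d = fps_X^2 * v^2 * (1 - fps_X * v)" and cl: "c * l = fps_X^3 * v^3"
    using c unfolding d_def l_def by algebra+
  have "c * v = c * (fps_X * (1 + fps_X * v + d))"
    using cd v unfolding c_def by algebra
  then have v': "v = fps_X * (1 + fps_X * v + d)"
    using c0 by simp
  have "c * d = c * (fps_X * v * (fps_X * v + d + l))"
    using cd cl unfolding c_def by algebra
  then have d': "d = fps_X * v * (fps_X * v + d + l)"
    using c0 by (metis mult_left_cancel)
  have "c * l = c * (fps_X * v * (d + l))"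
    using cd cl unfolding c_def by algebra
  then have l': "l = fps_X * v * (d + l)"
    using c0 by (metis mult_left_cancel)
  have "fps_X^2 * v * (1 + fps_X * v + d + l) = v - fps_X"
    using v' d' by algebra
  then show ?thesis
    unfolding A_eq_geometric[OF v' d' l'] by (simp flip: mult.assoc)
qed

section \<open>The algebraic equation\<close>

text \<open>
  The given equation in \<open>u\<close>, multiplied by \<open>x\<^sup>2\<close>, in terms of \<open>w = x u\<close>.
\<close>

definition cubic :: "'a::comm_ring_1 \<Rightarrow> 'a \<Rightarrow> 'a" where
  "cubic x w = w^3 - w^2 + 2 * x^2 * w - x^2 * w^2 - x^4 * w - x^6"

text \<open>The divided difference of \<open>cubic x\<close> between \<open>w\<close> and
  \<open>t\<close>. For series with constant term 1 its constant term is 3 - 2 = 1, so it is a unit;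
  this expresses that the root 1 at x = 0 is simple.\<close>

definition cubic_slope :: "'a::comm_ring_1 \<Rightarrow> 'a \<Rightarrow> 'a \<Rightarrow> 'a" where
  "cubic_slope x w t =
    w^2 + w * t + t^2 - (w + t) + 2 * x^2 - x^2 * (w + t) - x^4"

lemma cubic_diff: "cubic x w - cubic x t = (w - t) * cubic_slope x w t"
  unfolding cubic_def cubic_slope_def
  by (simp add: power2_eq_square power3_eq_cube algebra_simps)

lemma cubic_slope_nth_0:
  fixes w t :: "complex fps"
  assumes "fps_nth w 0 = 1" "fps_nth t 0 = 1"
  shows "fps_nth (cubic_slope fps_X w t) 0 = 1"
  using assms by (simp add: cubic_slope_def power2_eq_square power4_eq_xxxx mult.assoc)

lemma cubic_root_unique:
  fixes w w' :: "complex fps"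
  assumes "fps_nth w 0 = 1" "fps_nth w' 0 = 1" "cubic fps_X w = 0" "cubic fps_X w' = 0"
  shows "w = w'"
proof -
  have "(w - w') * cubic_slope fps_X w w' = 0"
    using cubic_diff[of fps_X w w'] assms by simp
  moreover have "cubic_slope fps_X w w' \<noteq> 0"
    using cubic_slope_nth_0[OF assms(1,2)] by auto
  ultimately show ?thesis by simp
qed

section \<open>Existence of the root by X-adic contraction\<close>

definition agree_below :: "nat \<Rightarrow> 'a::zero fps \<Rightarrow> 'a fps \<Rightarrow> bool" where
  "agree_below n f g \<longleftrightarrow> (\<forall>i<n. fps_nth f i = fps_nth g i)"

lemma agree_below_mult:
  fixes f g f' g' :: "'a::semiring_0 fps"
  shows "agree_below n f g \<Longrightarrow> agree_below n f' g' \<Longrightarrow> agree_below n (f * f') (g * g')"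
  by (auto simp: agree_below_def fps_mult_nth intro!: sum.cong)

lemma agree_below_power:
  fixes f g :: "'a::semiring_1 fps"
  shows "agree_below n f g \<Longrightarrow> agree_below n (f ^ m) (g ^ m)"
proof (induction m)
  case (Suc m)
  then show ?case by (simp add: agree_below_mult)
qed (simp add: agree_below_def)

lemma agree_below_add:
  fixes f g f' g' :: "'a::monoid_add fps"
  shows "agree_below n f g \<Longrightarrow> agree_below n f' g' \<Longrightarrow> agree_below n (f + f') (g + g')"
  by (auto simp: agree_below_def)

lemma agree_below_diff:
  fixes f g f' g' :: "'a::ab_group_add fps"
  shows "agree_below n f g \<Longrightarrow> agree_below n f' g' \<Longrightarrow> agree_below n (f - f') (g - g')"
  by (auto simp: agree_below_def)

lemma agree_below_refl [simp]: "agree_below n f f"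
  by (simp add: agree_below_def)

lemma agree_below_fps_X_mult:
  fixes f g :: "'a::semiring_1 fps"
  shows "agree_below n f g \<Longrightarrow> agree_below (Suc n) (fps_X * f) (fps_X * g)"
  by (auto simp: agree_below_def)

text \<open>Banach's fixed point argument in the X-adic metric: each application of the map fixes
  one more coefficient, so the iterates from 0 stabilise coefficientwise.\<close>

lemma fps_contraction_fixpoint:
  fixes \<Phi> :: "'a::zero fps \<Rightarrow> 'a fps"
  assumes contr: "\<And>n f g. agree_below n f g \<Longrightarrow> agree_below (Suc n) (\<Phi> f) (\<Phi> g)"
  shows "\<exists>f. \<Phi> f = f"
proof -
  define it where "it n = (\<Phi> ^^ n) 0" for n
  \<comment> \<open>Coefficient \<open>n\<close> is final from iterate \<open>Suc n\<close> on, so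
    the limit is read off diagonally.\<close>
  define f where "f = Abs_fps (\<lambda>n. fps_nth (it (Suc n)) n)"
  have step: "agree_below n (it n) (it (Suc n))" for n
  proof (induction n)
    case 0
    show ?case by (simp add: agree_below_def)
  next
    case (Suc n)
    then show ?case using contr[OF Suc] by (simp add: it_def)
  qed
  have agree: "agree_below n (it n) (it (n + m))" for n m
  proof (induction m)
    case (Suc m)
    then show ?case using step[of "n + m"] by (auto simp: agree_below_def)
  qed simp
  have lim: "agree_below n f (it n)" for n
    unfolding agree_below_def
  proof (intro allI impI)
    fix i assume "i < n"
    then obtain m where "n = Suc i + m" using less_natE by auto
    then show "fps_nth f i = fps_nth (it n) i"
      using agree[of "Suc i" m] by (auto simp: f_def agree_below_def)
  qed
  have "fps_nth (\<Phi> f) n = fps_nth f n" for n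
  proof -
    have "agree_below (Suc n) (\<Phi> f) (it (Suc n))"
      using contr[OF lim[of n]] by (simp add: it_def)
    then show ?thesis using lim[of "Suc n"] by (auto simp: agree_below_def)
  qed
  then show ?thesis by (intro exI[of _ f] fps_ext)
qed

lemma cubic_root_exists:
  obtains w :: "complex fps" where "fps_nth w 0 = 1" "cubic fps_X w = 0"
proof -
  \<comment> \<open>With v = 1/u the equation reads v = x G(v), where the factor x makes the map
    contracting. Then w = xu = x/v = 1/G(v).\<close>
  define G :: "complex fps \<Rightarrow> complex fps" where
    "G v = 1 - fps_X * v + 2 * v^2 - fps_X^2 * v^2 - fps_X^3 * v^3" for v
  have "agree_below (Suc n) (fps_X * G f) (fps_X * G g)" if "agree_below n f g" for n f g
    unfolding G_def
    by (intro agree_below_fps_X_mult agree_below_add agree_below_diff agree_below_mult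
        agree_below_power agree_below_refl that)
  from fps_contraction_fixpoint[of "\<lambda>f. fps_X * G f", OF this]
  obtain v where v: "fps_X * G v = v" by blast
  have v0: "fps_nth v 0 = 0"
    by (subst v[symmetric]) simp
  have G0: "fps_nth (G v) 0 = 1"
    by (simp add: G_def v0 power2_eq_square power3_eq_cube)
  define w where "w = inverse (G v)"
  have wG: "w * G v = 1"
    unfolding w_def by (rule inverse_mult_eq_1) (simp add: G0)
  \<comment> \<open>Replacing \<open>v\<close> by \<open>fps_X * G v\<close> leaves an equation in
    G(v) alone; multiplied by w^3 it becomes the cubic.\<close>
  have GX: "G v = 1 - fps_X^2 * G v + 2 * fps_X^2 * G v^2 - fps_X^4 * G v^2 - fps_X^6 * G v^3"
  proof -
    have "G v = 1 - fps_X * (fps_X * G v) + 2 * (fps_X * G v)^2 - fps_X^2 * (fps_X * G v)^2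
        - fps_X^3 * (fps_X * G v)^3"
      unfolding v by (rule G_def)
    then show ?thesis by algebra
  qed
  have "cubic fps_X w = 0"
    using wG GX unfolding cubic_def by algebra
  moreover have "fps_nth w 0 = 1"
    by (simp add: w_def G0)
  ultimately show ?thesis using that by blast
qed

text \<open>The truncation \<open>t\<close> solves the cubic up to a multiple of x^16, and the slope
  is a unit, so \<open>w - t\<close> is a multiple of x^16 too.\<close>

lemma cubic_root_expansion:
  fixes w :: "complex fps"
  assumes "fps_nth w 0 = 1" "cubic fps_X w = 0"
  obtains r where "w = 1 - fps_X^2 - fps_X^4 - 2 * fps_X^6 - 6 * fps_X^8 - 20 * fps_X^10
    - 71 * fps_X^12 - 262 * fps_X^14 + fps_X^16 * r"
proof -
  define t :: "complex fps" where
    "t = 1 - fps_X^2 - fps_X^4 - 2 * fps_X^6 - 6 * fps_X^8 - 20 * fps_X^10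
      - 71 * fps_X^12 - 262 * fps_X^14"
  \<comment> \<open>The exact cofactor, obtained by expanding \<open>cubic fps_X t\<close> and
    dividing by \<open>fps_X^16\<close>.\<close>
  define q :: "complex fps" where
    "q = 994 - 124 * fps_X^2 - 225 * fps_X^4 - 46 * fps_X^6 - 2302 * fps_X^8 - 18444 * fps_X^10
      - 108863 * fps_X^12 - 566730 * fps_X^14 - 793734 * fps_X^16 - 1698396 * fps_X^18
      - 3825743 * fps_X^20 - 8080866 * fps_X^22 - 14621172 * fps_X^24 - 17984728 * fps_X^26"
  define s where "s = cubic_slope fps_X w t"
  have "cubic fps_X t = fps_X^16 * q"
    unfolding cubic_def t_def q_def by algebra
  then have ws: "(w - t) * s = - (fps_X^16 * q)"
    using cubic_diff[of fps_X w t] assms by (simp add: s_def)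
  have "fps_nth t 0 = 1"
    by (simp add: t_def fps_numeral_fps_const)
  then have "fps_nth s 0 = 1"
    unfolding s_def using assms by (intro cubic_slope_nth_0)
  then have "s * inverse s = 1"
    by (intro inverse_mult_eq_1') simp
  with ws have "w = t + fps_X^16 * (- q * inverse s)"
    by algebra
  then show ?thesis
    unfolding t_def by (rule that)
qed

section \<open>Passage between the Laurent series u and the power series w = zu\<close>

lemma is_u1_imp_cubic_root:
  assumes "is_u1 u"
  obtains w where "fps_nth w 0 = 1" "cubic fps_X w = 0" "z * u = fps_to_fls w"
proof -
  define w where "w = fls_regpart (z * u)"
  have u: "fls_nth u n = fls_nth (1 / z - z - z^3 - 2 * z^5 - 6 * z^7 - 20 * z^9 - 71 * z^11
      - 262 * z^13) n" if "n < 15" for n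
    using assms that by (simp add: is_u1_def)
  \<comment> \<open>The prescribed coefficients include all negative exponents, so \<open>u\<close>
    has a simple pole with leading coefficient 1 and \<open>z * u\<close> is a power series with
    constant term 1.\<close>
  have neg: "fls_nth u n = (if n = - 1 then 1 else 0)" if "n < 0" for n
    using u[of n] that
    by (simp add: divide_inverse fls_inverse_X fls_times_nth mult.commute)
  have zu_nth: "fls_nth (z * u) n = fls_nth u (n - 1)" for n
    by (simp add: fls_X_times_conv_shift)
  have zu: "z * u = fps_to_fls w"
  proof (rule fls_eqI)
    fix n :: int
    show "fls_nth (z * u) n = fls_nth (fps_to_fls w) n"
    proof (cases "n < 0")
      case True
      then show ?thesis using neg[of "n - 1"] by (simp add: zu_nth)
    next
      case False
      then show ?thesis by (simp add: w_def)
    qed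
  qed
  have "fps_nth w 0 = fls_nth (z * u) 0"
    by (simp add: w_def)
  also have "\<dots> = 1"
    unfolding zu_nth using neg[of "- 1"] by simp
  finally have w0: "fps_nth w 0 = 1" .
  have "cubic z (z * u) =
      z^2 * (- (u^2) + z * u^3 + 2 * z * u - u^2 * z^2 - u * z^3 - z^4)"
    unfolding cubic_def by algebra
  also have "\<dots> = 0"
    using assms by (simp add: is_u1_def)
  finally have "fps_to_fls (cubic fps_X w) = 0"
    unfolding zu by (simp add: cubic_def fls_times_fps_to_fls fps_to_fls_power)
  then have "cubic fps_X w = 0" by simp
  with w0 zu show ?thesis by (intro that)
qed

lemma cubic_root_imp_is_u1:
  assumes w0: "fps_nth w 0 = 1" and w: "cubic fps_X w = 0"
  shows "is_u1 (fps_to_fls w / z)"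
proof -
  define u where "u = fps_to_fls w / z"
  have zu: "fps_to_fls w = z * u"
    unfolding u_def times_divide_eq_right by (rule nonzero_mult_div_cancel_left[symmetric]) simp
  have "z^2 * (- (u^2) + z * u^3 + 2 * z * u - u^2 * z^2 - u * z^3 - z^4) = cubic z (z * u)"
    unfolding cubic_def by algebra
  also have "\<dots> = fps_to_fls (cubic fps_X w)"
    unfolding zu[symmetric] by (simp add: cubic_def fls_times_fps_to_fls fps_to_fls_power)
  also have "\<dots> = 0"
    by (simp add: w)
  finally have eq: "- (u^2) + z * u^3 + 2 * z * u - u^2 * z^2 - u * z^3 - z^4 = 0"
    by simp
  obtain r where "w = 1 - fps_X^2 - fps_X^4 - 2 * fps_X^6 - 6 * fps_X^8 - 20 * fps_X^10
      - 71 * fps_X^12 - 262 * fps_X^14 + fps_X^16 * r"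
    using cubic_root_expansion[OF w0 w] .
  then have "fps_to_fls w = 1 - z^2 - z^4 - 2 * z^6 - 6 * z^8 - 20 * z^10
      - 71 * z^12 - 262 * z^14 + z^16 * fps_to_fls r"
    by (simp add: fls_times_fps_to_fls fps_to_fls_power)
  moreover have "z * (1 / z) = 1"
    unfolding times_divide_eq_right mult_1_right by (rule divide_self) simp
  ultimately have "z * u = z * (1 / z - z - z^3 - 2 * z^5 - 6 * z^7 - 20 * z^9 - 71 * z^11
      - 262 * z^13 + z^15 * fps_to_fls r)"
    unfolding zu by algebra
  then have u: "u = 1 / z - z - z^3 - 2 * z^5 - 6 * z^7 - 20 * z^9 - 71 * z^11
      - 262 * z^13 + z^15 * fps_to_fls r"
    unfolding mult_cancel_left by simp
  \<comment> \<open>Division by \<open>z\<close> turns the error term x^16 r into z^15 r, which is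
    invisible below exponent 15.\<close>
  have "fls_nth (z^15 * fps_to_fls r) n = 0" if "n < 15" for n
    using that by (simp add: fls_X_power_times_conv_shift)
  then have "\<forall>n<15. fls_nth u n = fls_nth (1 / z - z - z^3 - 2 * z^5 - 6 * z^7 - 20 * z^9
      - 71 * z^11 - 262 * z^13) n"
    unfolding u by simp
  with eq show ?thesis
    unfolding is_u1_def u_def[symmetric] by blast
qed

lemma A_eq_if_is_u1:
  assumes "is_u1 u"
  shows "fps_to_fls (A k) = (1 - z * u) / (z^2 * u ^ k)"
proof -
  obtain w where w0: "fps_nth w 0 = 1" and w: "cubic fps_X w = 0" and zu: "z * u = fps_to_fls w"
    using is_u1_imp_cubic_root[OF assms] .
  \<comment> \<open>This is 1/u as a power series; its equation is the cubic divided by w^3.\<close>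
  define v where "v = fps_X * inverse w"
  have iw: "w * inverse w = 1"
    by (rule inverse_mult_eq_1') (simp add: w0)
  then have wv: "w * v = fps_X"
    unfolding v_def by algebra
  have "v = fps_X * (1 - fps_X * v + 2 * v^2 - fps_X^2 * v^2 - fps_X^3 * v^3)"
    using iw w unfolding v_def cubic_def by algebra
  from arg_cong[OF fps_X_sq_mult_A[OF this, of k], of fps_to_fls]
  have A: "z^2 * fps_to_fls v * fps_to_fls (A k) = (fps_to_fls v - z) * fps_to_fls v ^ k"
    by (simp add: fls_times_fps_to_fls fps_to_fls_power)
  have "z * (u * fps_to_fls v) = fps_to_fls (w * v)"
    by (simp add: fls_times_fps_to_fls flip: zu)
  then have uv: "u * fps_to_fls v = 1"
    unfolding wv by simp
  then have u0: "u \<noteq> 0" by auto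
  \<comment> \<open>The extra factor \<open>u\<close> (in \<open>Suc k\<close>) cancels the
    \<open>v\<close> next to \<open>z^2\<close>; on the other side all powers of \<open>v\<close>
    cancel and \<open>v - z\<close> becomes \<open>1 - z * u\<close>.\<close>
  have "fps_to_fls (A k) * (z^2 * u ^ k) =
      u ^ Suc k * (z^2 * fps_to_fls v * fps_to_fls (A k))"
    using uv by (simp add: algebra_simps)
  also have "\<dots> = (u * fps_to_fls v - z * u) * (u * fps_to_fls v) ^ k"
    unfolding A by (simp add: power_mult_distrib algebra_simps)
  also have "\<dots> = 1 - z * u"
    unfolding uv by simp
  finally show ?thesis
    using u0 by (simp add: nonzero_eq_divide_eq)
qed

theorem theorem1:
  shows "(\<exists>!u1. is_u1 u1) \<and>
    (\<forall>u1. is_u1 u1 \<longrightarrow>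
      (\<forall>k. fps_to_fls (A k) = (1 - z * u1) / (z^2 * u1 ^ k)))"
proof (intro conjI allI impI)
  show "\<exists>!u1. is_u1 u1"
  proof (rule ex_ex1I)
    show "\<exists>u1. is_u1 u1"
      using cubic_root_exists cubic_root_imp_is_u1 by metis
  next
    fix u u' assume "is_u1 u" "is_u1 u'"
    then have "z * u = z * u'"
      using is_u1_imp_cubic_root cubic_root_unique by metis
    then show "u = u'" by simp
  qed
qed (rule A_eq_if_is_u1)

end
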